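(* Let $n\ge 2$. With $l_w, r_w$ ($w\in M_n$), $l_w,r_w,s_w$ ($w\in F_n$) and the linear maps $\mathfrak q:\mathbb R[M_n]\to\widehat{\mathcal C}(M_n)$, $q:\mathbb R[F_n]\to\widehat{\mathcal C}(F_n)$, $q_{\rm sym}:\mathbb R[F_n]\to\widehat{\mathcal B}(F_n)$ defined in the context, the following hold. (i) The space $K(M_n):=\ker(\mathfrak q)$ is spanned by the set $\bigcup_{w\in M_n}\{l_w,r_w\}$. (ii) The space $K(F_n):=\ker(q)$ is spanned by the set $\bigcup_{w\in F_n}\{l_w,r_w\}$. (iii) The space $K_{\rm sym}(F_n):=\ker(q_{\rm sym})$ is spanned by the set $\bigcup_{w\in F_n}\{l_w,r_w,s_w\}$.
   Context: Let $S=\{a_1,\dots,a_n\}$, $n\ge2$, and $\bar S=\{a_1,\dots,a_n,a_1^{-1},\dots,a_n^{-1}\}$. $M_n$ is the free monoid of all words over $S$ (including the empty word $e$); $F_n$ is the free group on $S$, viewed as the set of reduced words over $\bar S$. For $v=s_1\cdots s_l\neq e$ and $w=r_1\cdots r_m$ (words over $S$, resp. reduced words over $\bar S$), $\rho_v(w)$ is the number of $j\in\{0,\dots,m-l\}$ such that $s_i=r_{j+i}$ for all $i=1,\dots,l$ (so overlapping occurrences are counted; it is $0$ if $l>m$). Also $\rho_e(w)$ is the length of $w$. This defines the counting functions $\rho_v$ on $M_n$ (for $v\in M_n$) and on $F_n$ (for $v\in F_n$). $\mathcal C(M_n)$, $\mathcal C(F_n)$ are the real vector spaces of functions spanned by the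 respective counting functions; $\widehat{\mathcal C}(M_n)$, $\widehat{\mathcal C}(F_n)$ are their quotients by the subspace of bounded functions in them, and $[f]$ denotes the class of $f$. For $w\in F_n$ put $\phi_w:=\rho_w-\rho_{w^{-1}}:F_n\to\mathbb Z$, and let $\widehat{\mathcal B}(F_n)\subset\widehat{\mathcal C}(F_n)$ be the span of the classes $[\phi_w]$, $w\in F_n$. $\mathbb R[M_n]$ (resp. $\mathbb R[F_n]$) is the space of finitely supported real functions on $M_n$ (resp. $F_n$), with basis the indicator functions $\delta_g$. Define $\mathfrak q(\sum\lambda_g\delta_g)=[\sum\lambda_g\rho_g]$ on $\mathbb R[M_n]$, $q(\sum\lambda_g\delta_g)=[\sum\lambda_g\rho_g]$ on $\mathbb R[F_n]$, and $q_{\rm sym}(\sum\lambda_g\delta_g)=[\sum\lambda_g\phi_g]$ on $\mathbb R[F_n]$. For $w\in M_n$: $l_w:=\delta_w-\sum_{s\in S}\delta_{sw}$, $r_w:=\delta_w-\sum_{s\in S}\delta_{ws}$ (in particular $l_e=r_e=\delta_e-\sum_{s\in S}\delta_s$). For $w\in F_n\setminus\{e\}$ with first letter $w_1$ and last letter $w_{\rm fin}$: $l_w:=\delta_w-\sum_{s\in\bar S\setminus\{w_1^{-1}\}}\delta_{sw}$, $r_w:=\delta_w-\sum_{s\in\bar S\setminus\{w_{\rm fin}^{-1}\}}\delta_{ws}$, $s_w:=\delta_w+\delta_{w^{-1}}$; and in $F_n$, $l_e:=r_e:=\delta_e-\sum_{s\in\bar S}\delta_s$, $s_e:=2\delta_e$.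 *)

theory Defs
  imports "HOL-Analysis.Analysis" "HOL-Analysis.Finite_Function_Topology" "HOL-Library.Function_Algebras"
begin

section \<open>Real-valued functions as a real vector space\<close>

instantiation "fun" :: (type, real_vector) real_vector
begin

definition scaleR_fun :: "real \<Rightarrow> ('a \<Rightarrow> 'b) \<Rightarrow> 'a \<Rightarrow> 'b" where
  "scaleR_fun c f = (\<lambda>x. c *\<^sub>R f x)"

instance
  by standard (auto simp: scaleR_fun_def plus_fun_def fun_eq_iff algebra_simps)

end


section \<open>The free group as the set of reduced words\<close>

text \<open>The letter \<open>(a, True)\<close> is the generator \<open>a\<close> and \<open>(a, False)\<close> is its formal inverse.\<close>

type_synonym 'a letter = "'a \<times> bool"

definition inv_letter :: "'a letter \<Rightarrow> 'a letter" where
  "inv_letter s = (fst s, \<not> snd s)"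

definition reduced :: "'a letter list \<Rightarrow> bool" where
  "reduced w \<longleftrightarrow> successively (\<lambda>s t. t \<noteq> inv_letter s) w"

typedef 'a free_group = "{w :: 'a letter list. reduced w}"
  morphisms word_of Abs_free_group
  by (rule exI[of _ "[]"]) (simp add: reduced_def)

setup_lifting type_definition_free_group

text \<open>The product of two reduced words is their concatenation followed by free reduction.\<close>

fun cons_reduce :: "'a letter \<Rightarrow> 'a letter list \<Rightarrow> 'a letter list" where
  "cons_reduce s [] = [s]"
| "cons_reduce s (t # w) = (if t = inv_letter s then w else s # t # w)"

lemma inv_letter_inv_letter [simp]: "inv_letter (inv_letter s) = s"
  by (simp add: inv_letter_def)

lemma inv_letter_neq [simp]: "inv_letter s \<noteq> s" "s \<noteq> inv_letter s"
  by (auto simp: inv_letter_def prod_eq_iff)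

lemma reduced_Nil [simp]: "reduced []"
  by (simp add: reduced_def)

lemma reduced_Cons:
  "reduced (s # w) \<longleftrightarrow> reduced w \<and> (w \<noteq> [] \<longrightarrow> hd w \<noteq> inv_letter s)"
  by (auto simp: reduced_def successively_Cons)

lemma reduced_cons_reduce: "reduced w \<Longrightarrow> reduced (cons_reduce s w)"
  by (cases w) (auto simp: reduced_Cons)

lemma reduced_foldr_cons_reduce: "reduced w \<Longrightarrow> reduced (foldr cons_reduce v w)"
  by (induction v) (auto simp: reduced_cons_reduce)

lemma cons_reduce_inv_letter: "reduced w \<Longrightarrow> cons_reduce s (cons_reduce (inv_letter s) w) = w"
proof (cases w)
  case (Cons t u)
  assume "reduced w"
  with Cons show ?thesis by (cases u) (auto simp: reduced_Cons)
qed simp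

lemma foldr_cons_reduce_Nil: "reduced w \<Longrightarrow> foldr cons_reduce w [] = w"
proof (induction w)
  case (Cons s w)
  then show ?case by (cases w) (auto simp: reduced_Cons)
qed simp

lemma foldr_cons_reduce_cons:
  "reduced w \<Longrightarrow> foldr cons_reduce (cons_reduce s u) w = cons_reduce s (foldr cons_reduce u w)"
  by (cases u) (auto simp: cons_reduce_inv_letter reduced_foldr_cons_reduce)

lemma foldr_cons_reduce_assoc:
  "reduced w \<Longrightarrow>
     foldr cons_reduce (foldr cons_reduce u v) w = foldr cons_reduce u (foldr cons_reduce v w)"
  by (induction u) (auto simp: foldr_cons_reduce_cons)

lemma reduced_inverse: "reduced w \<Longrightarrow> reduced (rev (map inv_letter w))"
  by (auto simp: reduced_def successively_rev successively_map elim!: successively_mono)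

lemma foldr_cons_reduce_inverse:
  "reduced w \<Longrightarrow> foldr cons_reduce (rev (map inv_letter w)) w = []"
proof (induction w)
  case (Cons s w)
  then show ?case by (simp add: reduced_Cons)
qed simp

instantiation free_group :: (type) "{monoid_mult, inverse}"
begin

lift_definition one_free_group :: "'a free_group" is "[]"
  by simp

lift_definition times_free_group :: "'a free_group \<Rightarrow> 'a free_group \<Rightarrow> 'a free_group"
  is "\<lambda>v w. foldr cons_reduce v w"
  by (rule reduced_foldr_cons_reduce)

lift_definition inverse_free_group :: "'a free_group \<Rightarrow> 'a free_group"
  is "\<lambda>w. rev (map inv_letter w)"
  by (rule reduced_inverse)

definition divide_free_group :: "'a free_group \<Rightarrow> 'a free_group \<Rightarrow> 'a free_group" where
  "divide_free_group v w = v * inverse w"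

instance
proof
  fix u v w :: "'a free_group"
  show "u * v * w = u * (v * w)"
    by transfer (rule foldr_cons_reduce_assoc)
  show "1 * w = w"
    by transfer simp
  show "w * 1 = w"
    by transfer (rule foldr_cons_reduce_Nil)
qed

end

lemma free_group_left_inverse: "inverse w * w = (1 :: 'a free_group)"
  by transfer (rule foldr_cons_reduce_inverse)

lift_definition of_letter :: "'a letter \<Rightarrow> 'a free_group" is "\<lambda>s. [s]"
  by (simp add: reduced_def)

lemma word_of_of_letter_times:
  assumes "w = 1 \<or> s \<noteq> inv_letter (hd (word_of w))"
  shows "word_of (of_letter s * w) = s # word_of w"
  using assms
proof (transfer fixing: s)
  fix w :: "'a letter list"
  assume "w = [] \<or> s \<noteq> inv_letter (hd w)"
  then show "foldr cons_reduce [s] w = s # w"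
    by (cases w) (auto simp: inv_letter_def prod_eq_iff)
qed

lemma word_of_times_of_letter:
  assumes "w = 1 \<or> s \<noteq> inv_letter (last (word_of w))"
  shows "word_of (w * of_letter s) = word_of w @ [s]"
  using assms
proof (transfer fixing: s)
  fix w :: "'a letter list"
  assume w: "reduced w" "w = [] \<or> s \<noteq> inv_letter (last w)"
  then have "reduced (w @ [s])"
    by (auto simp: reduced_def successively_append_iff)
  from foldr_cons_reduce_Nil[OF this] show "foldr cons_reduce w [s] = w @ [s]"
    by simp
qed


section \<open>Counting functions\<close>

definition subword_count :: "'l list \<Rightarrow> 'l list \<Rightarrow> nat" where
  "subword_count v w =
     (if v = [] then length w
      else card {j. j + length v \<le> length w \<and> (\<forall>i < length v. v ! i = w ! (j + i))})"

text \<open>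
  The constructions below only use the family of counting functions \<open>\<rho> v\<close>, so they are made
  once for both monoids: the free monoid \<open>'a list\<close> and the free group \<open>'a free_group\<close>.
\<close>

class counting =
  fixes \<rho> :: "'a \<Rightarrow> 'a \<Rightarrow> nat"

instantiation list :: (type) counting
begin
definition \<rho>_list :: "'a list \<Rightarrow> 'a list \<Rightarrow> nat" where
  "\<rho>_list v w = subword_count v w"
instance ..
end

instantiation free_group :: (type) counting
begin
definition \<rho>_free_group :: "'a free_group \<Rightarrow> 'a free_group \<Rightarrow> nat" where
  "\<rho>_free_group v w = subword_count (word_of v) (word_of w)"
instance ..
end

definition counting_fun :: "'w::counting \<Rightarrow> 'w \<Rightarrow> real" where
  "counting_fun v = (\<lambda>w. real (\<rho> v w))"

definition counting_space :: "('w::counting \<Rightarrow> real) set" where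
  "counting_space = span (range counting_fun)"

lemma subspace_counting_space: "subspace counting_space"
  by (simp add: counting_space_def)

lemma counting_fun_in_space: "counting_fun v \<in> counting_space"
  by (simp add: counting_space_def span_base)


section \<open>The quotient by the bounded functions\<close>

definition bounded_diff :: "('w::counting \<Rightarrow> real) \<Rightarrow> ('w \<Rightarrow> real) \<Rightarrow> bool" where
  "bounded_diff f g \<longleftrightarrow>
     f \<in> counting_space \<and> g \<in> counting_space \<and> bounded (range (f - g))"

lemma bounded_range_add:
  fixes f g :: "'w \<Rightarrow> real"
  assumes "bounded (range f)" "bounded (range g)"
  shows "bounded (range (f + g))"
  using bounded_plus_comp[OF assms] by (simp add: plus_fun_def)

lemma bounded_range_scaleR:
  fixes f :: "'w \<Rightarrow> real"
  assumes "bounded (range f)"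
  shows "bounded (range (c *\<^sub>R f))"
  using bounded_scaleR_comp[OF assms, of c] by (simp add: scaleR_fun_def)

lemma bounded_range_zero: "bounded (range (0 :: 'w \<Rightarrow> real))"
  by (auto simp: bounded_iff)

lemma bounded_diff_refl: "f \<in> counting_space \<Longrightarrow> bounded_diff f f"
  by (simp add: bounded_diff_def bounded_range_zero del: zero_fun_apply)

lemma part_equivp_bounded_diff: "part_equivp (bounded_diff :: ('w::counting \<Rightarrow> real) \<Rightarrow> _)"
proof (rule part_equivpI)
  have "bounded_diff 0 (0 :: 'w \<Rightarrow> real)"
    by (rule bounded_diff_refl) (rule subspace_0[OF subspace_counting_space])
  then show "\<exists>f :: 'w \<Rightarrow> real. bounded_diff f f"
    by blast
  show "symp (bounded_diff :: ('w \<Rightarrow> real) \<Rightarrow> _)"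
  proof (rule sympI)
    fix f g :: "'w \<Rightarrow> real"
    assume "bounded_diff f g"
    then show "bounded_diff g f"
      using bounded_range_scaleR[of "f - g" "-1"] by (simp add: bounded_diff_def)
  qed
  show "transp (bounded_diff :: ('w \<Rightarrow> real) \<Rightarrow> _)"
  proof (rule transpI)
    fix f g h :: "'w \<Rightarrow> real"
    assume "bounded_diff f g" "bounded_diff g h"
    then show "bounded_diff f h"
      using bounded_range_add[of "f - g" "g - h"] by (simp add: bounded_diff_def)
  qed
qed

text \<open>
  Because the relation is partial, the elements of the quotient type are exactly the classes
  of functions in \<^const>\<open>counting_space\<close>.
\<close>

quotient_type (overloaded) 'w counting_quotient = "'w::counting \<Rightarrow> real" / partial: bounded_diff
  by (rule part_equivp_bounded_diff)

instantiation counting_quotient :: (counting) real_vector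
begin

lift_definition zero_counting_quotient :: "'a counting_quotient" is 0
  by (rule bounded_diff_refl) (rule subspace_0[OF subspace_counting_space])

lift_definition plus_counting_quotient ::
    "'a counting_quotient \<Rightarrow> 'a counting_quotient \<Rightarrow> 'a counting_quotient" is "(+)"
proof -
  fix f f' g g' :: "'a \<Rightarrow> real"
  assume "bounded_diff f f'" "bounded_diff g g'"
  then show "bounded_diff (f + g) (f' + g')"
    using bounded_range_add[of "f - f'" "g - g'"]
    by (simp add: bounded_diff_def subspace_add[OF subspace_counting_space] add_diff_add)
qed

lift_definition scaleR_counting_quotient ::
    "real \<Rightarrow> 'a counting_quotient \<Rightarrow> 'a counting_quotient" is "(*\<^sub>R)"
proof -
  fix c :: real and f g :: "'a \<Rightarrow> real"
  assume "bounded_diff f g"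
  then show "bounded_diff (c *\<^sub>R f) (c *\<^sub>R g)"
    using bounded_range_scaleR[of "f - g" c]
    by (simp add: bounded_diff_def subspace_scale[OF subspace_counting_space] scaleR_right_diff_distrib)
qed

lift_definition uminus_counting_quotient ::
    "'a counting_quotient \<Rightarrow> 'a counting_quotient" is uminus
proof -
  fix f g :: "'a \<Rightarrow> real"
  assume "bounded_diff f g"
  then show "bounded_diff (- f) (- g)"
    using bounded_range_scaleR[of "f - g" "-1"]
    by (simp add: bounded_diff_def subspace_neg[OF subspace_counting_space])
qed

lift_definition minus_counting_quotient ::
    "'a counting_quotient \<Rightarrow> 'a counting_quotient \<Rightarrow> 'a counting_quotient" is "(-)"
proof -
  fix f f' g g' :: "'a \<Rightarrow> real"
  assume "bounded_diff f f'" "bounded_diff g g'"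
  then show "bounded_diff (f - g) (f' - g')"
    using bounded_range_add[of "f - f'" "(-1) *\<^sub>R (g - g')"] bounded_range_scaleR[of "g - g'" "-1"]
    by (simp add: bounded_diff_def subspace_diff[OF subspace_counting_space] algebra_simps)
qed

instance
  by (standard; transfer;
      auto simp: algebra_simps bounded_diff_def intro!: bounded_range_zero
        subspace_add[OF subspace_counting_space] subspace_scale[OF subspace_counting_space]
        subspace_diff[OF subspace_counting_space] subspace_neg[OF subspace_counting_space]
        subspace_0[OF subspace_counting_space] simp del: zero_fun_apply)

end


section \<open>The linear maps\<close>

lift_definition q :: "('w::counting \<Rightarrow>\<^sub>0 real) \<Rightarrow> 'w counting_quotient" is
  "\<lambda>x. \<Sum>g \<in> Poly_Mapping.keys x. Poly_Mapping.lookup x g *\<^sub>R counting_fun g"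
  by (intro bounded_diff_refl subspace_sum[OF subspace_counting_space]
        subspace_scale[OF subspace_counting_space] counting_fun_in_space)

definition phi :: "'a free_group \<Rightarrow> 'a free_group \<Rightarrow> real" where
  "phi w = counting_fun w - counting_fun (inverse w)"

lemma phi_in_space: "phi w \<in> counting_space"
  by (simp add: phi_def subspace_diff[OF subspace_counting_space] counting_fun_in_space)

lift_definition phi_class :: "'a free_group \<Rightarrow> 'a free_group counting_quotient" is phi
  by (rule bounded_diff_refl) (rule phi_in_space)

definition Bhat :: "'a free_group counting_quotient set" where
  "Bhat = span (range phi_class)"

lift_definition q_sym :: "('a free_group \<Rightarrow>\<^sub>0 real) \<Rightarrow> 'a free_group counting_quotient" is
  "\<lambda>x. \<Sum>g \<in> Poly_Mapping.keys x. Poly_Mapping.lookup x g *\<^sub>R phi g"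
  by (intro bounded_diff_refl subspace_sum[OF subspace_counting_space]
        subspace_scale[OF subspace_counting_space] phi_in_space)

text \<open>The linear extension of a map given on the basis of a space of finitely supported functions.\<close>

lemma linear_extension:
  fixes F :: "'w \<Rightarrow> 'b::real_vector"
  shows "linear (\<lambda>x :: 'w \<Rightarrow>\<^sub>0 real.
    \<Sum>g \<in> Poly_Mapping.keys x. Poly_Mapping.lookup x g *\<^sub>R F g)"
    (is "linear ?L")
proof -
  have L: "?L x = (\<Sum>g \<in> A. Poly_Mapping.lookup x g *\<^sub>R F g)"
    if "finite A" "Poly_Mapping.keys x \<subseteq> A" for x A
    using that by (intro sum.mono_neutral_left) (auto simp: in_keys_iff)
  have lookup_scaleR: "Poly_Mapping.lookup (c *\<^sub>R x) g = c * Poly_Mapping.lookup x g"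
    for c and x :: "'w \<Rightarrow>\<^sub>0 real" and g
    by (simp add: scaleR_poly_mapping_def)
  show ?thesis
  proof (rule linearI)
    fix x y :: "'w \<Rightarrow>\<^sub>0 real"
    let ?A = "Poly_Mapping.keys x \<union> Poly_Mapping.keys y"
    have "?L (x + y) = (\<Sum>g \<in> ?A. Poly_Mapping.lookup (x + y) g *\<^sub>R F g)"
      by (rule L) (simp_all add: keys_add)
    also have "\<dots> = (\<Sum>g \<in> ?A. Poly_Mapping.lookup x g *\<^sub>R F g)
        + (\<Sum>g \<in> ?A. Poly_Mapping.lookup y g *\<^sub>R F g)"
      by (simp add: lookup_add scaleR_left_distrib sum.distrib)
    finally show "?L (x + y) = ?L x + ?L y"
      by (simp add: L[of ?A x] L[of ?A y])
  next
    fix c :: real and x :: "'w \<Rightarrow>\<^sub>0 real"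
    have "?L (c *\<^sub>R x) = (\<Sum>g \<in> Poly_Mapping.keys x. Poly_Mapping.lookup (c *\<^sub>R x) g *\<^sub>R F g)"
      by (rule L) (auto simp: in_keys_iff lookup_scaleR)
    then show "?L (c *\<^sub>R x) = c *\<^sub>R ?L x"
      by (simp add: lookup_scaleR scaleR_sum_right)
  qed
qed

lemma linear_q: "linear q"
proof (rule linearI)
  fix c :: real and x y :: "'w::counting \<Rightarrow>\<^sub>0 real"
  note lin = linear_extension[of "counting_fun :: 'w \<Rightarrow> _"]
  have in_space: "(\<Sum>g \<in> Poly_Mapping.keys z. Poly_Mapping.lookup z g *\<^sub>R counting_fun g) \<in> counting_space"
    for z :: "'w \<Rightarrow>\<^sub>0 real"
    by (intro subspace_sum[OF subspace_counting_space]
        subspace_scale[OF subspace_counting_space] counting_fun_in_space)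
  show "q (x + y) = q x + q y"
    by transfer (simp only: linear_add[OF lin] bounded_diff_refl in_space
        subspace_add[OF subspace_counting_space])
  show "q (c *\<^sub>R x) = c *\<^sub>R q x"
    by transfer (simp only: linear_scale[OF lin] bounded_diff_refl in_space
        subspace_scale[OF subspace_counting_space])
qed

lemma linear_q_sym: "linear q_sym"
proof (rule linearI)
  fix c :: real and x y :: "'a free_group \<Rightarrow>\<^sub>0 real"
  note lin = linear_extension[of "phi :: 'a free_group \<Rightarrow> _"]
  have in_space: "(\<Sum>g \<in> Poly_Mapping.keys z. Poly_Mapping.lookup z g *\<^sub>R phi g) \<in> counting_space"
    for z :: "'a free_group \<Rightarrow>\<^sub>0 real"
    by (intro subspace_sum[OF subspace_counting_space]
        subspace_scale[OF subspace_counting_space] phi_in_space)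
  show "q_sym (x + y) = q_sym x + q_sym y"
    by transfer (simp only: linear_add[OF lin] bounded_diff_refl in_space
        subspace_add[OF subspace_counting_space])
  show "q_sym (c *\<^sub>R x) = c *\<^sub>R q_sym x"
    by transfer (simp only: linear_scale[OF lin] bounded_diff_refl in_space
        subspace_scale[OF subspace_counting_space])
qed

lemma q_sym_single: "q_sym (Poly_Mapping.single w 1) = phi_class w"
  by transfer (simp add: bounded_diff_refl phi_in_space)

lemma q_sym_in_Bhat: "q_sym x \<in> Bhat"
proof (induction x rule: update_induct)
  case const
  show ?case
    by (simp add: linear_0[OF linear_q_sym] Bhat_def span_zero)
next
  case (update x w c)
  have "Poly_Mapping.update w c x = x + c *\<^sub>R Poly_Mapping.single w (1::real)"
    using update.hyps
    by (intro poly_mapping_eqI)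
      (auto simp: scaleR_poly_mapping_def lookup_single lookup_add lookup_update when_def in_keys_iff)
  with update.IH show ?case
    by (simp add: linear_add[OF linear_q_sym] linear_scale[OF linear_q_sym] q_sym_single
        Bhat_def span_add span_scale span_base)
qed


section \<open>The relations\<close>

abbreviation \<delta> :: "'w \<Rightarrow> 'w \<Rightarrow>\<^sub>0 real" where
  "\<delta> w \<equiv> Poly_Mapping.single w 1"

definition l_mon :: "'a::finite list \<Rightarrow> 'a list \<Rightarrow>\<^sub>0 real" where
  "l_mon w = \<delta> w - (\<Sum>s\<in>UNIV. \<delta> (s # w))"

definition r_mon :: "'a::finite list \<Rightarrow> 'a list \<Rightarrow>\<^sub>0 real" where
  "r_mon w = \<delta> w - (\<Sum>s\<in>UNIV. \<delta> (w @ [s]))"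

definition l_grp :: "'a::finite free_group \<Rightarrow> 'a free_group \<Rightarrow>\<^sub>0 real" where
  "l_grp w =
     (if w = 1 then \<delta> 1 - (\<Sum>s\<in>UNIV. \<delta> (of_letter s))
      else \<delta> w - (\<Sum>s \<in> UNIV - {inv_letter (hd (word_of w))}. \<delta> (of_letter s * w)))"

definition r_grp :: "'a::finite free_group \<Rightarrow> 'a free_group \<Rightarrow>\<^sub>0 real" where
  "r_grp w =
     (if w = 1 then \<delta> 1 - (\<Sum>s\<in>UNIV. \<delta> (of_letter s))
      else \<delta> w - (\<Sum>s \<in> UNIV - {inv_letter (last (word_of w))}. \<delta> (w * of_letter s)))"

text \<open>For \<open>w = 1\<close> this is \<open>2 \<delta> 1\<close>.\<close>

definition s_grp :: "'a free_group \<Rightarrow> 'a free_group \<Rightarrow>\<^sub>0 real" where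
  "s_grp w = \<delta> w + \<delta> (inverse w)"

end

theory Submission
  imports Defs
begin

text \<open>
  Both the free monoid and the free group are languages of admissible words over a finite
  alphabet, where admissibility only restricts pairs of neighbouring letters: no restriction for
  the monoid, \<open>t \<noteq> s\<^sup>-\<^sup>1\<close> after \<open>s\<close> for the group. All that the argument uses is that any two letters
  can be joined by an admissible word. For the group this needs rank at least two, so
  that a letter different from two given ones exists. The locale \<open>counted_words\<close> treats
  both cases at once.

  The relations lie in the kernel because every occurrence of \<open>v\<close> in \<open>w\<close> extends by one letter to the
  left, except an occurrence at the very beginning of \<open>w\<close>; and likewise on the right.

  Conversely, let \<open>q x = 0\<close>. Right relations replace each word by its one-letter extensions, so
  modulo the relations all words in \<open>x\<close> have the same length \<open>N + 1 \<ge> 2\<close>. Consider the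
  graph with the admissible words of length \<open>N\<close> as vertices, in which a word \<open>w\<close> of length \<open>N + 1\<close>
  is an edge from \<open>butlast w\<close> to \<open>tl w\<close>. A longer admissible word is a path in this graph, and
  the combination of counting functions given by \<open>x\<close> adds up the coefficients \<open>c w\<close>
  of \<open>x\<close> along that path (\<open>count_sum_level\<close>). Since these sums are bounded and a
  cycle can be traversed arbitrarily often, \<open>c\<close> sums to \<open>0\<close> around every cycle. As the graph is strongly
  connected, \<open>c\<close> is the coboundary of a function \<open>P\<close> on the vertices,
  \<open>c w = P (tl w) - P (butlast w)\<close> (\<open>bounded_window_sum_coboundary\<close>). Collecting
  the edges at each vertex \<open>u\<close> then gives \<open>x = (\<Sum>u. P u (r\<^sub>u - l\<^sub>u))\<close> (\<open>level_kernel\<close>).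

  For the symmetrized map let \<open>x'\<close> be obtained from \<open>x\<close> by inverting the basis elements. Then
  \<open>q_sym x = q (x - x')\<close>, and \<open>x = (x - x') / 2 + (x + x') / 2\<close> splits an element
  of the kernel into one of the kernel of \<open>q\<close> and a combination of the \<open>s\<^sub>w\<close>.
\<close>

section \<open>Occurrences of a word\<close>

text \<open>
  Positions are traded for factorizations \<open>w = a v b\<close>: recursion on the first letter and
  reversal then become operations on \<open>a\<close> and \<open>b\<close>, without index arithmetic.
\<close>

lemma subword_count_eq_card_splits:
  assumes "v \<noteq> []"
  shows "subword_count v w = card {(a, b). w = a @ v @ b}"
proof -
  let ?J = "{j. j + length v \<le> length w \<and> (\<forall>i < length v. v ! i = w ! (j + i))}"
  let ?f = "\<lambda>j. (take j w, drop (j + length v) w)"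
  have "bij_betw ?f ?J {(a, b). w = a @ v @ b}"
  proof (rule bij_betwI')
    fix i j assume "i \<in> ?J" "j \<in> ?J"
    then show "?f i = ?f j \<longleftrightarrow> i = j"
      by auto (metis add_leD1 length_take min.absorb2)
  next
    fix j assume j: "j \<in> ?J"
    then have "v = take (length v) (drop j w)"
      by (intro nth_equalityI) auto
    then show "?f j \<in> {(a, b). w = a @ v @ b}"
      by (metis (mono_tags, lifting) append_take_drop_id case_prodI drop_drop mem_Collect_eq add.commute)
  next
    fix p assume "p \<in> {(a, b). w = a @ v @ b}"
    then obtain a b where p: "p = (a, b)" "w = a @ v @ b"
      by auto
    then show "\<exists>j\<in>?J. p = ?f j"
      by (intro bexI[of _ "length a"]) (auto simp: nth_append)
  qed
  from bij_betw_same_card[OF this] show ?thesis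
    using assms by (simp add: subword_count_def)
qed

lemma subword_count_Nil_right [simp]: "subword_count v [] = 0"
  by (cases "v = []") (auto simp: subword_count_def)

lemma finite_splits: "finite {(a, b). w = a @ v @ b}"
proof (rule finite_subset)
  show "{(a, b). w = a @ v @ b} \<subseteq>
      (\<lambda>(i, j). (take i w, drop j w)) ` ({..length w} \<times> {..length w})"
  proof (rule subsetI)
    fix p assume "p \<in> {(a, b). w = a @ v @ b}"
    then obtain a b where "p = (a, b)" "w = a @ v @ b"
      by auto
    then show "p \<in> (\<lambda>(i, j). (take i w, drop j w)) ` ({..length w} \<times> {..length w})"
      by (intro image_eqI[of _ _ "(length a, length a + length v)"]) auto
  qed
qed auto

text \<open>
  The recursion also covers \<open>v = []\<close>: the convention that the empty word counts letters makes
  it occur once at every position that carries a letter.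
\<close>

lemma subword_count_Cons:
  fixes v w :: "'l list"
  shows "subword_count v (t # w) = of_bool (take (length v) (t # w) = v) + subword_count v w"
proof (cases "v = []")
  case True
  then show ?thesis by (simp add: subword_count_def)
next
  case False
  let ?A = "{([] :: 'l list, b) | b. t # w = v @ b}" and ?B = "{(a, b). w = a @ v @ b}"
  let ?f = "\<lambda>(a, b). (t # a, b :: 'l list)"
  have split: "{(a, b). t # w = a @ v @ b} = ?A \<union> ?f ` ?B"
    by (auto simp: Cons_eq_append_conv image_iff)
  have A_eq: "?A = (if take (length v) (t # w) = v then {([], drop (length v) (t # w))} else {})"
    by (auto simp: append_eq_conv_conj) (metis append_take_drop_id)+
  have A: "finite ?A" "card ?A = of_bool (take (length v) (t # w) = v)"
    unfolding A_eq by simp_all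
  have "card (?A \<union> ?f ` ?B) = card ?A + card (?f ` ?B)"
    by (rule card_Un_disjoint) (auto simp: A(1) finite_splits)
  also have "card (?f ` ?B) = card ?B"
    by (rule card_image) (auto simp: inj_on_def)
  finally show ?thesis
    using False A(2) split by (simp add: subword_count_eq_card_splits)
qed

lemma subword_count_rev: "subword_count (rev v) (rev w) = subword_count v w"
proof (cases "v = []")
  case True
  then show ?thesis by (simp add: subword_count_def)
next
  case False
  have "bij_betw (\<lambda>(a, b). (rev b, rev a)) {(a, b). w = a @ v @ b} {(a, b). rev w = a @ rev v @ b}"
    by (rule bij_betwI[where g = "\<lambda>(a, b). (rev b, rev a)"]) (auto simp: rev_swap)
  from bij_betw_same_card[OF this] show ?thesis
    using False by (simp add: subword_count_eq_card_splits)
qed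

lemma subword_count_map:
  assumes "inj f"
  shows "subword_count (map f v) (map f w) = subword_count v w"
proof -
  have "{j. j + length v \<le> length w \<and> (\<forall>i < length v. map f v ! i = map f w ! (j + i))} =
      {j. j + length v \<le> length w \<and> (\<forall>i < length v. v ! i = w ! (j + i))}"
    by (auto simp: inj_eq[OF assms])
  then show ?thesis by (simp add: subword_count_def)
qed

lemma successively_take: "successively R w \<Longrightarrow> successively R (take n w)"
  by (metis append_take_drop_id successively_append_iff)

text \<open>
  An occurrence of \<open>v\<close> that is not at the beginning of \<open>w\<close> is preceded by exactly one letter \<open>s\<close>, and
  \<open>s v\<close> is admissible as a part of \<open>w\<close>. There is no correction for \<open>v = []\<close>, since every
  letter of \<open>w\<close> is counted on both sides.
\<close>

lemma subword_count_left_extensions: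
  fixes v w :: "'l::finite list"
  assumes "successively R w"
  shows "subword_count v w =
    of_bool (v \<noteq> [] \<and> take (length v) w = v) +
      (\<Sum>s | successively R (s # v). subword_count (s # v) w)"
  using assms
proof (induction w)
  case Nil
  then show ?case by auto
next
  case (Cons t w)
  have adm: "successively R (t # v)" if "take (length v) w = v"
    using successively_take[OF Cons.prems, of "Suc (length v)"] that by simp
  have "(\<Sum>s | successively R (s # v). of_bool (t = s \<and> take (length v) w = v)) =
      (\<Sum>s | successively R (s # v). if s = t then of_bool (take (length v) w = v) else (0::nat))"
    by (rule sum.cong) auto
  also have "\<dots> = of_bool (take (length v) w = v)"
    using adm by (subst sum.delta) auto
  finally have "(\<Sum>s | successively R (s # v). subword_count (s # v) (t # w)) =
      of_bool (take (length v) w = v) + (\<Sum>s | successively R (s # v). subword_count (s # v) w)"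
    by (simp add: subword_count_Cons sum.distrib)
  moreover have "subword_count v w = of_bool (v \<noteq> [] \<and> take (length v) w = v) +
      (\<Sum>s | successively R (s # v). subword_count (s # v) w)"
    using Cons.prems by (intro Cons.IH) (auto simp: successively_Cons)
  ultimately show ?case
    by (auto simp: subword_count_Cons[of v])
qed

text \<open>
  The mirror image of the previous lemma: reversal turns words admissible for \<open>R\<close> into words
  admissible for the converse relation.
\<close>

lemma subword_count_right_extensions:
  fixes v w :: "'l::finite list"
  assumes "successively R w"
  shows "subword_count v w =
    of_bool (v \<noteq> [] \<and> take (length v) (rev w) = rev v) +
      (\<Sum>s | successively R (v @ [s]). subword_count (v @ [s]) w)"
proof -
  have rev: "successively (\<lambda>x y. R y x) (rev u) \<longleftrightarrow> successively R u" for u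
    by simp
  have "successively (\<lambda>x y. R y x) (s # rev v) \<longleftrightarrow> successively R (v @ [s])" for s
    using rev[of "v @ [s]"] by simp
  moreover have "subword_count (s # rev v) (rev w) = subword_count (v @ [s]) w" for s
    using subword_count_rev[of "v @ [s]" w] by simp
  ultimately show ?thesis
    using subword_count_left_extensions[of "\<lambda>x y. R y x" "rev w" "rev v"] assms
    by (simp add: subword_count_rev)
qed


section \<open>Weights with bounded sums along words\<close>

lemma successively_overlap:
  assumes "successively R (a @ v)" "successively R (v @ b)" "v \<noteq> []"
  shows "successively R (a @ v @ b)"
  using assms by (auto simp: successively_append_iff)

text \<open>
  For \<open>N = n + 1\<close> this is the weight of a word read as a path through its factors of length \<open>n\<close>,
  where the edges are the factors of length \<open>N\<close>, weighted by \<open>c\<close>.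
\<close>

fun window_sum :: "nat \<Rightarrow> ('l list \<Rightarrow> real) \<Rightarrow> 'l list \<Rightarrow> real" where
  "window_sum N c [] = 0"
| "window_sum N c (s # w) =
     (if N \<le> length (s # w) then c (take N (s # w)) else 0) + window_sum N c w"

lemma window_sum_short: "length w < N \<Longrightarrow> window_sum N c w = 0"
  by (induction w) auto

text \<open>
  Path weights are additive when paths are joined at a common vertex \<open>v\<close>.
\<close>

lemma window_sum_overlap:
  "length v = N \<Longrightarrow>
     window_sum (Suc N) c (a @ v @ b) = window_sum (Suc N) c (a @ v) + window_sum (Suc N) c (v @ b)"
  by (induction a) (auto simp: window_sum_short)

lemma window_sum_single: "length w = Suc N \<Longrightarrow> window_sum (Suc N) c w = c w"
  by (cases w) (auto simp: window_sum_short)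

text \<open>
  Irreducibility is strong connectedness of the graph of letters. By \<open>connecting_word\<close> it passes
  to the graphs whose vertices are the admissible words of a fixed length.
\<close>

locale irreducible_relation =
  fixes R :: "'l \<Rightarrow> 'l \<Rightarrow> bool"
  assumes irreducible: "\<exists>z. successively R (s # z @ [t])"
begin

abbreviation "adm \<equiv> successively R"

lemma connecting_word:
  assumes "adm u" "adm v" "u \<noteq> []" "v \<noteq> []"
  obtains d where "adm (u @ d @ v)"
proof -
  obtain z where "adm (last u # z @ [hd v])"
    using irreducible by blast
  then have "adm (u @ z @ v)"
    using assms by (cases "z = []") (auto simp: successively_append_iff successively_Cons)
  then show ?thesis by (rule that)
qed

text \<open>
  A closed path at the vertex \<open>u\<close> is an admissible word that begins and ends with \<open>u\<close>; going
  around it \<open>k\<close> times multiplies the weight by \<open>k\<close>. That the result begins with \<open>u\<close> is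
  what allows another round to be attached in front.
\<close>

lemma power_of_cycle:
  assumes "length u = N" "u \<noteq> []" "adm ((u @ d) @ u)"
  shows "\<exists>b. concat (replicate k (u @ d)) @ u = u @ b \<and> adm (u @ b) \<and>
    window_sum (Suc N) c (u @ b) = real k * window_sum (Suc N) c ((u @ d) @ u)"
proof (induction k)
  case 0
  show ?case
    using assms by (intro exI[of _ "[]"]) (auto simp: successively_append_iff window_sum_short)
next
  case (Suc k)
  then obtain b where b: "concat (replicate k (u @ d)) @ u = u @ b" "adm (u @ b)"
    "window_sum (Suc N) c (u @ b) = real k * window_sum (Suc N) c ((u @ d) @ u)"
    by blast
  have "adm ((u @ d) @ u @ b)"
    using successively_overlap[OF assms(3) b(2) assms(2)] .
  moreover have "window_sum (Suc N) c ((u @ d) @ u @ b) =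
      real (Suc k) * window_sum (Suc N) c ((u @ d) @ u)"
    using window_sum_overlap[OF assms(1), of c "u @ d" b] b(3) by (simp add: algebra_simps)
  moreover have "concat (replicate (Suc k) (u @ d)) @ u = u @ (d @ u @ b)"
    using b(1) by simp
  ultimately show ?case
    by (intro exI[of _ "d @ u @ b"]) simp
qed

lemma window_sum_cycle:
  assumes bound: "\<And>w. adm w \<Longrightarrow> \<bar>window_sum (Suc N) c w\<bar> \<le> B"
    and u: "length u = N" "u \<noteq> []" "adm ((u @ d) @ u)"
  shows "window_sum (Suc N) c ((u @ d) @ u) = 0"
proof (rule ccontr)
  let ?x = "window_sum (Suc N) c ((u @ d) @ u)"
  assume "?x \<noteq> 0"
  then obtain k where k: "B < real k * \<bar>?x\<bar>"
    using reals_Archimedean3[of "\<bar>?x\<bar>"] by auto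
  obtain b where "adm (u @ b)" "window_sum (Suc N) c (u @ b) = real k * ?x"
    using power_of_cycle[OF u] by blast
  with bound[of "u @ b"] k show False
    by (simp add: abs_mult)
qed

text \<open>
  Closing both paths from \<open>u\<close> to \<open>v\<close> by the same way back \<open>d\<close> gives two cycles of weight
  zero, so both paths have the negative weight of the way back.
\<close>

lemma window_sum_path_independent:
  assumes bound: "\<And>w. adm w \<Longrightarrow> \<bar>window_sum (Suc N) c w\<bar> \<le> B"
    and u: "length u = N" "u \<noteq> []" and v: "length v = N"
    and paths: "adm (u @ b @ v)" "adm (u @ b' @ v)"
  shows "window_sum (Suc N) c (u @ b @ v) = window_sum (Suc N) c (u @ b' @ v)"
proof -
  have "v \<noteq> []" "adm u" "adm v"
    using u v paths by (auto simp: successively_append_iff)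
  then obtain d where d: "adm (v @ d @ u)"
    using u connecting_word by metis
  have "window_sum (Suc N) c (u @ a @ v) = - window_sum (Suc N) c (v @ d @ u)"
    if a: "adm (u @ a @ v)" for a
  proof -
    have "adm ((u @ a @ v @ d) @ u)"
      using successively_overlap[of R "u @ a" v "d @ u"] a d \<open>v \<noteq> []\<close> by simp
    then have "window_sum (Suc N) c ((u @ a @ v @ d) @ u) = 0"
      using window_sum_cycle[OF bound u, of "a @ v @ d"] by simp
    then show ?thesis
      using window_sum_overlap[OF v, of c "u @ a" "d @ u"] by simp
  qed
  with paths show ?thesis by simp
qed

text \<open>
  As for a conservative vector field, the potential \<open>P v\<close> is the weight of some path from a fixed
  vertex \<open>u\<close> to \<open>v\<close>; appending the edge \<open>w\<close> to the chosen path to \<open>butlast w\<close> gives a path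
  to \<open>tl w\<close>, which by path independence has the same weight as the chosen one.
\<close>

lemma bounded_window_sum_coboundary:
  assumes bound: "\<And>w. adm w \<Longrightarrow> \<bar>window_sum (Suc N) c w\<bar> \<le> B" and "N > 0"
  obtains P where "\<And>w. adm w \<Longrightarrow> length w = Suc N \<Longrightarrow> c w = P (tl w) - P (butlast w)"
proof (cases "\<exists>u. adm u \<and> length u = N")
  case False
  have "\<not> (adm w \<and> length w = Suc N)" for w
    using False successively_take[of R w N] by fastforce
  then show ?thesis using that by blast
next
  case True
  then obtain u where u: "adm u" "length u = N" "u \<noteq> []"
    using \<open>N > 0\<close> by auto
  define path where "path v = (SOME b. adm (u @ b @ v))" for v
  define P where "P v = window_sum (Suc N) c (u @ path v @ v)" for v
  have path: "adm (u @ path v @ v)" if "adm v" "length v = N" for v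
  proof -
    have "\<exists>b. adm (u @ b @ v)"
      using connecting_word[OF u(1) that(1) u(3)] that(2) \<open>N > 0\<close> by (metis length_greater_0_conv)
    then show ?thesis
      unfolding path_def by (rule someI_ex)
  qed
  show ?thesis
  proof (rule that[of P])
    fix w assume w: "adm w" "length w = Suc N"
    then obtain s w' where sw: "w = s # w'"
      by (cases w) auto
    with w \<open>N > 0\<close> obtain m t where mt: "w' = m @ [t]"
      by (cases w' rule: rev_cases) auto
    let ?x = "s # m" and ?y = "m @ [t]"
    have len: "length ?x = N" "length ?y = N"
      using w sw mt by auto
    have adm: "adm ?x" "adm ?y"
      using w(1) sw mt successively_append_iff[of R "s # m" "[t]"] by (auto simp: successively_Cons)
    \<comment> \<open>The edge \<open>w = s m t\<close> leads from \<open>s m\<close> to \<open>m t\<close>.\<close>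
    have "adm ((u @ path ?x) @ ?x @ [t])"
      using path[OF adm(1) len(1)] w(1) by (intro successively_overlap) (simp_all add: sw mt)
    then have "adm (u @ (path ?x @ [s]) @ ?y)"
      by simp
    then have "P ?y = window_sum (Suc N) c (u @ (path ?x @ [s]) @ ?y)"
      unfolding P_def
      using window_sum_path_independent[OF bound u(2,3) len(2)] path[OF adm(2) len(2)] by blast
    also have "\<dots> = window_sum (Suc N) c ((u @ path ?x) @ ?x) + window_sum (Suc N) c (?x @ [t])"
      using window_sum_overlap[OF len(1), of c "u @ path ?x" "[t]"] by simp
    also have "\<dots> = P ?x + c w"
      using window_sum_single[OF w(2), of c] by (simp add: P_def sw mt)
    finally show "c w = P (tl w) - P (butlast w)"
      by (simp add: sw mt butlast_append)
  qed
qed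

end


section \<open>The kernel for an irreducible language\<close>

lemma sum_fun_apply: "(\<Sum>i\<in>A. f i) x = (\<Sum>i\<in>A. f i x)"
  by (induction A rule: infinite_finite_induct) auto

definition count_sum :: "('w::counting \<Rightarrow>\<^sub>0 real) \<Rightarrow> 'w \<Rightarrow> real" where
  "count_sum x = (\<Sum>g \<in> Poly_Mapping.keys x. Poly_Mapping.lookup x g *\<^sub>R counting_fun g)"

lemma linear_count_sum: "linear count_sum"
  unfolding count_sum_def by (rule linear_extension)

lemma count_sum_single: "count_sum (\<delta> g) = counting_fun g"
  by (simp add: count_sum_def)

lemma q_eq_0_iff:
  fixes x :: "'w::counting \<Rightarrow>\<^sub>0 real"
  shows "q x = 0 \<longleftrightarrow> bounded (range (count_sum x))"
proof -
  have "count_sum x \<in> counting_space"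
    unfolding count_sum_def by (intro subspace_sum[OF subspace_counting_space]
        subspace_scale[OF subspace_counting_space] counting_fun_in_space)
  moreover have "(0 :: 'w \<Rightarrow> real) \<in> counting_space"
    by (rule subspace_0[OF subspace_counting_space])
  moreover have "q x = 0 \<longleftrightarrow> bounded_diff (count_sum x) 0"
    unfolding count_sum_def by transfer (rule refl)
  ultimately show ?thesis
    by (simp add: bounded_diff_def)
qed

lemma sum_lookup_single:
  fixes x :: "'w \<Rightarrow>\<^sub>0 real"
  shows "x = (\<Sum>g \<in> Poly_Mapping.keys x. Poly_Mapping.lookup x g *\<^sub>R \<delta> g)"
proof (rule poly_mapping_eqI)
  fix h
  have "Poly_Mapping.lookup (\<Sum>g \<in> Poly_Mapping.keys x. Poly_Mapping.lookup x g *\<^sub>R \<delta> g) h =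
      (\<Sum>g \<in> Poly_Mapping.keys x. if g = h then Poly_Mapping.lookup x h else 0)"
    unfolding lookup_sum by (rule sum.cong) (auto simp: scaleR_poly_mapping_def lookup_single)
  also have "\<dots> = Poly_Mapping.lookup x h"
    by (simp add: in_keys_iff)
  finally show "Poly_Mapping.lookup x h =
      Poly_Mapping.lookup (\<Sum>g \<in> Poly_Mapping.keys x. Poly_Mapping.lookup x g *\<^sub>R \<delta> g) h" ..
qed

lemma span_range_single: "span (range (\<delta> :: 'w \<Rightarrow> 'w \<Rightarrow>\<^sub>0 real)) = UNIV"
proof -
  have "x \<in> span (range \<delta>)" for x :: "'w \<Rightarrow>\<^sub>0 real"
    by (subst sum_lookup_single[of x]) (intro span_sum span_scale span_base rangeI)
  then show ?thesis by auto
qed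

lemma linear_eq_on_single:
  fixes f g :: "('w \<Rightarrow>\<^sub>0 real) \<Rightarrow> 'b::real_vector"
  assumes "linear f" "linear g" "\<And>w. f (\<delta> w) = g (\<delta> w)"
  shows "f x = g x"
proof -
  let ?s = "\<Sum>g \<in> Poly_Mapping.keys x. Poly_Mapping.lookup x g *\<^sub>R \<delta> g"
  have "f ?s = g ?s"
    by (simp add: linear_sum[OF assms(1)] linear_sum[OF assms(2)]
        linear_scale[OF assms(1)] linear_scale[OF assms(2)] assms(3))
  then show ?thesis
    by (simp flip: sum_lookup_single)
qed

text \<open>
  The elements of \<open>'w\<close> stand for the admissible words via \<open>word\<close>, so that the free group,
  whose elements are not literally lists, fits as well as the free monoid.
\<close>

locale counted_words = irreducible_relation R
  for R :: "'l::finite \<Rightarrow> 'l \<Rightarrow> bool" +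
  fixes word :: "'w::counting \<Rightarrow> 'l list"
  assumes inj_word: "inj word"
    and range_word: "range word = {v. successively R v}"
    and rho_word: "\<rho> g h = subword_count (word g) (word h)"
begin

abbreviation elt :: "'l list \<Rightarrow> 'w" where
  "elt \<equiv> inv word"

lemma elt_word [simp]: "elt (word g) = g"
  by (rule inv_f_f[OF inj_word])

lemma word_elt [simp]: "adm v \<Longrightarrow> word (elt v) = v"
  using range_word by (auto intro: f_inv_into_f)

lemma adm_word [simp]: "adm (word g)"
  using range_word by auto

definition left_rel :: "'w \<Rightarrow> 'w \<Rightarrow>\<^sub>0 real" where
  "left_rel g = \<delta> g - (\<Sum>s | adm (s # word g). \<delta> (elt (s # word g)))"

definition right_rel :: "'w \<Rightarrow> 'w \<Rightarrow>\<^sub>0 real" where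
  "right_rel g = \<delta> g - (\<Sum>s | adm (word g @ [s]). \<delta> (elt (word g @ [s])))"

definition rels :: "('w \<Rightarrow>\<^sub>0 real) set" where
  "rels = (\<Union>g. {left_rel g, right_rel g})"

lemma left_rel_in_kernel: "q (left_rel g) = 0"
proof -
  have "count_sum (left_rel g) h =
      of_bool (word g \<noteq> [] \<and> take (length (word g)) (word h) = word g)" for h
    using subword_count_left_extensions[OF adm_word, of "word g" h]
    by (simp add: left_rel_def linear_diff[OF linear_count_sum] linear_sum[OF linear_count_sum]
        count_sum_single counting_fun_def rho_word sum_fun_apply)
  then show ?thesis
    unfolding q_eq_0_iff by (auto simp: bounded_iff intro!: exI[of _ 1])
qed

lemma right_rel_in_kernel: "q (right_rel g) = 0"
proof -
  have "count_sum (right_rel g) h =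
      of_bool (word g \<noteq> [] \<and> take (length (word g)) (rev (word h)) = rev (word g))" for h
    using subword_count_right_extensions[OF adm_word, of "word g" h]
    by (simp add: right_rel_def linear_diff[OF linear_count_sum] linear_sum[OF linear_count_sum]
        count_sum_single counting_fun_def rho_word sum_fun_apply)
  then show ?thesis
    unfolding q_eq_0_iff by (auto simp: bounded_iff intro!: exI[of _ 1])
qed

lemma subspace_kernel: "subspace {x. q x = 0}"
  by (rule linear_subspace_kernel[OF linear_q])

lemma span_rels_subset_kernel: "span rels \<subseteq> {x. q x = 0}"
  by (rule span_minimal[OF _ subspace_kernel])
    (auto simp: rels_def left_rel_in_kernel right_rel_in_kernel)

definition level :: "nat \<Rightarrow> 'l list set" where
  "level N = {v. adm v \<and> length v = N}"

lemma finite_level: "finite (level N)"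
  using finite_lists_length_eq[of "UNIV :: 'l set" N]
  by (rule rev_finite_subset) (auto simp: level_def)

text \<open>
  Right relations lengthen a word one letter at a time up to length \<open>N\<close>.
\<close>

lemma single_in_span_level:
  "length (word g) + k = N \<Longrightarrow> \<delta> g \<in> span (rels \<union> (\<lambda>v. \<delta> (elt v)) ` level N)"
proof (induction k arbitrary: g)
  case 0
  then have "\<delta> g \<in> (\<lambda>v. \<delta> (elt v)) ` level N"
    by (intro image_eqI[of _ _ "word g"]) (auto simp: level_def)
  then show ?case by (intro span_base) simp
next
  case (Suc k)
  have "right_rel g \<in> rels"
    by (auto simp: rels_def)
  then have "right_rel g + (\<Sum>s | adm (word g @ [s]). \<delta> (elt (word g @ [s]))) \<in>
      span (rels \<union> (\<lambda>v. \<delta> (elt v)) ` level N)"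
    using Suc.prems by (intro span_add span_sum Suc.IH) (auto intro: span_base)
  then show ?case
    by (simp add: right_rel_def)
qed

text \<open>
  If all words in \<open>x\<close> have the same length, each factor of that length of \<open>w\<close> contributes its
  coefficient, so evaluating the counting functions is a path sum.
\<close>

lemma count_sum_level:
  assumes keys: "\<And>g. g \<in> Poly_Mapping.keys x \<Longrightarrow> length (word g) = Suc N"
    and "adm w"
  shows "count_sum x (elt w) = window_sum (Suc N) (\<lambda>v. Poly_Mapping.lookup x (elt v)) w"
proof -
  have "(\<Sum>g\<in>Poly_Mapping.keys x. Poly_Mapping.lookup x g * real (subword_count (word g) w)) =
      window_sum (Suc N) (\<lambda>v. Poly_Mapping.lookup x (elt v)) w"
    using \<open>adm w\<close>
  proof (induction w)
    case Nil
    show ?case by simp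
  next
    case (Cons t w)
    let ?v = "take (Suc N) (t # w)"
    have v: "adm ?v"
      by (rule successively_take[OF Cons.prems])
    have "(\<Sum>g\<in>Poly_Mapping.keys x. Poly_Mapping.lookup x g *
          of_bool (take (length (word g)) (t # w) = word g)) =
        (\<Sum>g\<in>Poly_Mapping.keys x. if g = elt ?v then
          (if Suc N \<le> length (t # w) then Poly_Mapping.lookup x g else 0) else 0)"
    proof (rule sum.cong)
      fix g assume g: "g \<in> Poly_Mapping.keys x"
      have "?v = word g \<longleftrightarrow> g = elt ?v"
        using v word_elt elt_word by metis
      moreover have "Suc N \<le> length (t # w)" if "?v = word g"
        using arg_cong[OF that, of length] keys[OF g] by simp
      ultimately show "Poly_Mapping.lookup x g *
            of_bool (take (length (word g)) (t # w) = word g) =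
          (if g = elt ?v then
            (if Suc N \<le> length (t # w) then Poly_Mapping.lookup x g else 0) else 0)"
        unfolding keys[OF g] by auto
    qed simp
    also have "\<dots> = (if Suc N \<le> length (t # w) then Poly_Mapping.lookup x (elt ?v) else 0)"
      by (subst sum.delta) (auto simp: in_keys_iff)
    finally have "(\<Sum>g\<in>Poly_Mapping.keys x. Poly_Mapping.lookup x g *
          of_bool (take (length (word g)) (t # w) = word g)) =
        (if Suc N \<le> length (t # w) then Poly_Mapping.lookup x (elt ?v) else 0)" .
    moreover have "adm w"
      using Cons.prems by (auto simp: successively_Cons)
    ultimately show ?case
      by (simp only: subword_count_Cons of_nat_add of_nat_of_bool distrib_left sum.distrib
          Cons.IH window_sum.simps)
  qed
  then show ?thesis
    using \<open>adm w\<close>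
    by (simp add: count_sum_def sum_fun_apply scaleR_fun_def counting_fun_def rho_word)
qed

text \<open>
  Both sides group the edges \<open>w\<close> by their end vertex \<open>u = tl w\<close>: the edges into \<open>u\<close>
  are the left extensions of \<open>u\<close>, and their sum is \<open>\<delta> u - l\<^sub>u\<close>. The next lemma does the same for
  initial vertices and right extensions.
\<close>

lemma sum_level_tl:
  "(\<Sum>w\<in>level (Suc N). P (tl w) *\<^sub>R \<delta> (elt w)) =
    (\<Sum>u\<in>level N. P u *\<^sub>R (\<delta> (elt u) - left_rel (elt u)))"
proof -
  have "(\<Sum>u\<in>level N. P u *\<^sub>R (\<delta> (elt u) - left_rel (elt u))) =
      (\<Sum>u\<in>level N. \<Sum>s | adm (s # u). P u *\<^sub>R \<delta> (elt (s # u)))"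
    by (rule sum.cong) (auto simp: left_rel_def level_def scaleR_sum_right)
  also have "\<dots> = (\<Sum>(u, s)\<in>(SIGMA u:level N. {s. adm (s # u)}). P u *\<^sub>R \<delta> (elt (s # u)))"
    by (rule sum.Sigma) (auto simp: finite_level)
  also have "\<dots> = (\<Sum>w\<in>level (Suc N). P (tl w) *\<^sub>R \<delta> (elt w))"
    by (rule sum.reindex_bij_witness[where i = "\<lambda>w. (tl w, hd w)" and j = "\<lambda>(u, s). s # u"])
      (auto simp: level_def length_Suc_conv successively_Cons)
  finally show ?thesis ..
qed

lemma sum_level_butlast:
  "(\<Sum>w\<in>level (Suc N). P (butlast w) *\<^sub>R \<delta> (elt w)) =
    (\<Sum>u\<in>level N. P u *\<^sub>R (\<delta> (elt u) - right_rel (elt u)))"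
proof -
  have "(\<Sum>u\<in>level N. P u *\<^sub>R (\<delta> (elt u) - right_rel (elt u))) =
      (\<Sum>u\<in>level N. \<Sum>s | adm (u @ [s]). P u *\<^sub>R \<delta> (elt (u @ [s])))"
    by (rule sum.cong) (auto simp: right_rel_def level_def scaleR_sum_right)
  also have "\<dots> = (\<Sum>(u, s)\<in>(SIGMA u:level N. {s. adm (u @ [s])}). P u *\<^sub>R \<delta> (elt (u @ [s])))"
    by (rule sum.Sigma) (auto simp: finite_level)
  also have "\<dots> = (\<Sum>w\<in>level (Suc N). P (butlast w) *\<^sub>R \<delta> (elt w))"
    by (rule sum.reindex_bij_witness[where i = "\<lambda>w. (butlast w, last w)" and j = "\<lambda>(u, s). u @ [s]"])
      (auto simp: level_def length_Suc_conv_rev successively_append_iff)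
  finally show ?thesis ..
qed

lemma level_kernel:
  assumes keys: "\<And>g. g \<in> Poly_Mapping.keys x \<Longrightarrow> length (word g) = Suc N"
    and "N > 0" and "q x = 0"
  shows "x \<in> span rels"
proof -
  let ?c = "\<lambda>v. Poly_Mapping.lookup x (elt v)"
  from \<open>q x = 0\<close> obtain B where "\<And>h. \<bar>count_sum x h\<bar> \<le> B"
    unfolding q_eq_0_iff bounded_iff by auto
  then have "\<bar>window_sum (Suc N) ?c w\<bar> \<le> B" if "adm w" for w
    using count_sum_level[OF keys that] by metis
  then obtain P where P: "\<And>w. adm w \<Longrightarrow> length w = Suc N \<Longrightarrow> ?c w = P (tl w) - P (butlast w)"
    using bounded_window_sum_coboundary[OF _ \<open>N > 0\<close>] by metis
  have "x = (\<Sum>g\<in>elt ` level (Suc N). Poly_Mapping.lookup x g *\<^sub>R \<delta> g)"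
  proof (subst sum_lookup_single[of x], rule sum.mono_neutral_left)
    show "Poly_Mapping.keys x \<subseteq> elt ` level (Suc N)"
      using keys by (auto simp: level_def intro!: image_eqI[of _ _ "word _"])
  qed (auto simp: finite_level in_keys_iff)
  also have "\<dots> = (\<Sum>w\<in>level (Suc N). ?c w *\<^sub>R \<delta> (elt w))"
    by (subst sum.reindex) (auto simp: level_def intro!: inj_onI dest: arg_cong[where f = word])
  also have "\<dots> = (\<Sum>w\<in>level (Suc N). P (tl w) *\<^sub>R \<delta> (elt w)) -
      (\<Sum>w\<in>level (Suc N). P (butlast w) *\<^sub>R \<delta> (elt w))"
    by (simp add: P level_def scaleR_left_diff_distrib flip: sum_subtractf)
  also have "\<dots> = (\<Sum>u\<in>level N. P u *\<^sub>R (right_rel (elt u) - left_rel (elt u)))"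
    unfolding sum_level_tl sum_level_butlast
    by (simp add: scaleR_right_diff_distrib flip: sum_subtractf)
  also have "\<dots> \<in> span rels"
    by (intro span_sum span_scale span_diff span_base) (auto simp: rels_def)
  finally show ?thesis .
qed

lemma keys_span_level:
  assumes "x \<in> span ((\<lambda>v. \<delta> (elt v)) ` level N)" "g \<in> Poly_Mapping.keys x"
  shows "length (word g) = N"
proof -
  have "x \<in> {x. \<forall>g. length (word g) \<noteq> N \<longrightarrow> Poly_Mapping.lookup x g = 0}"
    using assms(1)
  proof (rule subsetD[OF span_minimal, rotated 2])
    show "subspace {x :: 'w \<Rightarrow>\<^sub>0 real. \<forall>g. length (word g) \<noteq> N \<longrightarrow> Poly_Mapping.lookup x g = 0}"
      by (auto simp: subspace_def lookup_add scaleR_poly_mapping_def)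
  qed (auto simp: level_def lookup_single when_def)
  with assms(2) show ?thesis
    by (auto simp: in_keys_iff)
qed

text \<open>
  Relations bring \<open>x\<close> into the form \<open>y + z\<close> with \<open>y\<close> a combination of relations and \<open>z\<close>
  supported on a single length, which is the case settled by \<open>level_kernel\<close>.
\<close>

theorem kernel_eq_span_rels: "{x. q x = 0} = span rels"
proof (rule antisym)
  show "span rels \<subseteq> {x. q x = 0}"
    by (rule span_rels_subset_kernel)
  show "{x. q x = 0} \<subseteq> span rels"
  proof clarify
    fix x :: "'w \<Rightarrow>\<^sub>0 real" assume "q x = 0"
    \<comment> \<open>The length \<open>N + 1\<close> bounds all words in \<open>x\<close>, and \<open>N > 0\<close>.\<close>
    define N where "N = Suc (\<Sum>g\<in>Poly_Mapping.keys x. length (word g))"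
    let ?D = "(\<lambda>v. \<delta> (elt v)) ` level (Suc N)"
    have "length (word g) \<le> Suc N" if "g \<in> Poly_Mapping.keys x" for g
      using member_le_sum[OF that, of "\<lambda>g. length (word g)"] by (simp add: N_def)
    then have "\<delta> g \<in> span (rels \<union> ?D)" if "g \<in> Poly_Mapping.keys x" for g
      using that single_in_span_level[of g "Suc N - length (word g)"] by fastforce
    then have "x \<in> span (rels \<union> ?D)"
      by (subst sum_lookup_single[of x]) (intro span_sum span_scale)
    then obtain y z where yz: "x = y + z" "y \<in> span rels" "z \<in> span ?D"
      by (auto simp: span_Un)
    have "q y = 0"
      using yz(2) span_rels_subset_kernel by auto
    with \<open>q x = 0\<close> have "q z = 0"
      using linear_add[OF linear_q, of y z] yz(1) by simp
    with keys_span_level[OF yz(3)] have "z \<in> span rels"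
      by (intro level_kernel[of z N]) (auto simp: N_def)
    with yz show "x \<in> span rels"
      by (simp add: span_add)
  qed
qed

end


section \<open>The free monoid and the free group\<close>

lemma kernel_free_monoid:
  "{x :: 'a::finite list \<Rightarrow>\<^sub>0 real. q x = 0} = span (\<Union>w. {l_mon w, r_mon w})"
proof -
  have adm: "successively (\<lambda>_ _. True) v" for v :: "'a list"
    by (induction v rule: induct_list012) auto
  interpret counted_words "\<lambda>_ _. True" "id :: 'a list \<Rightarrow> _"
    by standard (auto simp: adm \<rho>_list_def)
  have "left_rel w = l_mon w" "right_rel w = r_mon w" for w
    by (simp_all add: left_rel_def right_rel_def l_mon_def r_mon_def adm)
  then show ?thesis
    using kernel_eq_span_rels by (simp add: rels_def)
qed

text \<open>
  Two letters \<open>s\<close> and \<open>t\<close> are joined by any letter \<open>z\<close> that cancels with neither of them; with at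
  least four letters in total such a \<open>z\<close> exists.
\<close>

lemma kernel_free_group:
  assumes "CARD('a::finite) \<ge> 2"
  shows "{x :: 'a free_group \<Rightarrow>\<^sub>0 real. q x = 0} = span (\<Union>w. {l_grp w, r_grp w})"
proof -
  let ?R = "\<lambda>s t :: 'a letter. t \<noteq> inv_letter s"
  interpret counted_words ?R word_of
  proof
    fix s t :: "'a letter"
    have "card {inv_letter s, inv_letter t} < card (UNIV :: 'a letter set)"
      using assms card_insert_le_m1[of 2 "{inv_letter t}" "inv_letter s"]
      by (simp add: card_UNIV_bool)
    then obtain z where "z \<notin> {inv_letter s, inv_letter t}"
      by (metis UNIV_I card_mono finite not_less subsetI)
    then have "successively ?R (s # [z] @ [t])"
      by auto
    then show "\<exists>z. successively ?R (s # z @ [t])" ..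
  next
    show "inj (word_of :: 'a free_group \<Rightarrow> _)"
      by (simp add: inj_def word_of_inject)
    show "range word_of = {v. successively ?R v}"
      using type_definition.Rep_range[OF type_definition_free_group] by (simp add: reduced_def)
  qed (rule \<rho>_free_group_def)
  have elt_eq: "elt v = g" if "word_of g = v" for v g
    using that elt_word by blast
  have Nil: "word_of (1 :: 'a free_group) = []"
    by (rule one_free_group.rep_eq)
  have Nil_iff: "word_of w = [] \<longleftrightarrow> w = 1" for w :: "'a free_group"
    using Nil word_of_inject[of w 1] by simp
  have letter: "word_of (of_letter s) = [s]" for s :: "'a letter"
    by (rule of_letter.rep_eq)
  have "left_rel w = l_grp w" for w
  proof (cases "w = 1")
    case True
    then show ?thesis
      by (simp add: left_rel_def l_grp_def Nil elt_eq[OF letter])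
  next
    case False
    have "{s. adm (s # word_of w)} = UNIV - {inv_letter (hd (word_of w))}"
      using adm_word[of w] False by (auto simp: successively_Cons Nil_iff)
    moreover have "elt (s # word_of w) = of_letter s * w" if "s \<noteq> inv_letter (hd (word_of w))" for s
      using that by (intro elt_eq word_of_of_letter_times) simp
    ultimately show ?thesis
      using False by (simp add: left_rel_def l_grp_def)
  qed
  moreover have "right_rel w = r_grp w" for w
  proof (cases "w = 1")
    case True
    then show ?thesis
      by (simp add: right_rel_def r_grp_def Nil elt_eq[OF letter])
  next
    case False
    have "{s. adm (word_of w @ [s])} = UNIV - {inv_letter (last (word_of w))}"
      using adm_word[of w] False by (auto simp: successively_append_iff Nil_iff)
    moreover have "elt (word_of w @ [s]) = w * of_letter s" if "s \<noteq> inv_letter (last (word_of w))" for s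
      using that by (intro elt_eq word_of_times_of_letter) simp
    ultimately show ?thesis
      using False by (simp add: right_rel_def r_grp_def)
  qed
  ultimately show ?thesis
    using kernel_eq_span_rels by (simp add: rels_def)
qed


section \<open>Symmetrization\<close>

definition inverse_basis :: "('a free_group \<Rightarrow>\<^sub>0 real) \<Rightarrow> 'a free_group \<Rightarrow>\<^sub>0 real" where
  "inverse_basis x = (\<Sum>g \<in> Poly_Mapping.keys x. Poly_Mapping.lookup x g *\<^sub>R \<delta> (inverse g))"

lemma linear_inverse_basis: "linear inverse_basis"
  unfolding inverse_basis_def by (rule linear_extension)

lemma inverse_basis_single [simp]: "inverse_basis (\<delta> g) = \<delta> (inverse g)"
  by (simp add: inverse_basis_def)

lemma inverse_inverse_free_group [simp]: "inverse (inverse g) = (g :: 'a free_group)"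
  by transfer (simp add: rev_map o_def)

lemma counting_fun_inverse: "counting_fun (inverse g) h = counting_fun g (inverse h :: 'a free_group)"
proof -
  have inj: "inj (inv_letter :: 'a letter \<Rightarrow> _)"
    by (rule inj_on_inverseI[of _ inv_letter]) simp
  have "\<rho> (inverse g) (inverse k) = \<rho> g k" for g k :: "'a free_group"
    by (simp add: \<rho>_free_group_def inverse_free_group.rep_eq subword_count_rev subword_count_map[OF inj])
  from this[of g "inverse h"] show ?thesis
    by (simp add: counting_fun_def)
qed

lemma count_sum_inverse_basis: "count_sum (inverse_basis x) h = count_sum x (inverse h)"
proof (rule linear_eq_on_single[of "\<lambda>x. count_sum (inverse_basis x) h" "\<lambda>x. count_sum x (inverse h)"])
  show "linear (\<lambda>x. count_sum (inverse_basis x) h)" "linear (\<lambda>x. count_sum x (inverse h))"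
    by (auto intro!: linearI simp: linear_add[OF linear_count_sum] linear_scale[OF linear_count_sum]
        linear_add[OF linear_inverse_basis] linear_scale[OF linear_inverse_basis] scaleR_fun_def)
qed (simp add: count_sum_single counting_fun_inverse)

text \<open>
  Inverting the basis elements amounts to composing the counting functions with inversion on the
  free group, which does not affect boundedness.
\<close>

lemma q_inverse_basis: "q x = 0 \<Longrightarrow> q (inverse_basis x) = 0"
  unfolding q_eq_0_iff
  by (rule bounded_subset) (auto simp: count_sum_inverse_basis)

lemma phi_class_eq: "phi_class g = q (\<delta> g) - q (\<delta> (inverse g))"
  by transfer (simp add: bounded_diff_refl phi_in_space flip: phi_def)

lemma q_sym_eq: "q_sym x = q (x - inverse_basis x)"
proof (rule linear_eq_on_single[of q_sym "\<lambda>x. q (x - inverse_basis x)"])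
  show "linear (\<lambda>x :: 'a free_group \<Rightarrow>\<^sub>0 real. q (x - inverse_basis x))"
    using linear_compose[OF linear_compose_sub[OF linear_id linear_inverse_basis] linear_q]
    by (simp add: o_def id_def)
qed (simp_all add: linear_q_sym q_sym_single phi_class_eq linear_diff[OF linear_q])

text \<open>
  The elements \<open>x - inverse_basis x\<close> and \<open>x + inverse_basis x\<close> are twice the
  antisymmetric and symmetric parts of \<open>x\<close>. The first lies in the kernel of \<open>q\<close> if
  \<open>q_sym x = 0\<close>, and the second is always a combination of the \<open>s\<^sub>w\<close>.
\<close>

lemma kernel_q_sym:
  "{x :: 'a::finite free_group \<Rightarrow>\<^sub>0 real. q_sym x = 0} = span ({x. q x = 0} \<union> range s_grp)"
proof (rule antisym)
  have "x \<in> span ({x. q x = 0} \<union> range s_grp)" if "q_sym x = 0" for x :: "'a free_group \<Rightarrow>\<^sub>0 real"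
  proof -
    have "linear (\<lambda>x :: 'a free_group \<Rightarrow>\<^sub>0 real. x + inverse_basis x)"
      using linear_compose_add[OF linear_id linear_inverse_basis] by simp
    then have "x + inverse_basis x =
        (\<Sum>g \<in> Poly_Mapping.keys x. Poly_Mapping.lookup x g *\<^sub>R s_grp g)"
      by (subst linear_eq_on_single[OF _ linear_extension[of s_grp]]) (simp_all add: s_grp_def)
    also have "\<dots> \<in> span ({x. q x = 0} \<union> range s_grp)"
      by (intro span_sum span_scale span_base) simp
    finally have "x + inverse_basis x \<in> span ({x. q x = 0} \<union> range s_grp)" .
    moreover have "x - inverse_basis x \<in> span ({x. q x = 0} \<union> range s_grp)"
      using that by (intro span_base) (simp add: q_sym_eq)
    ultimately have "(1 / 2) *\<^sub>R ((x + inverse_basis x) + (x - inverse_basis x)) \<in>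
        span ({x. q x = 0} \<union> range s_grp)"
      by (rule span_scale[OF span_add])
    also have "(x + inverse_basis x) + (x - inverse_basis x) = 2 *\<^sub>R x"
      by (simp add: scaleR_2)
    finally show ?thesis by simp
  qed
  then show "{x :: 'a free_group \<Rightarrow>\<^sub>0 real. q_sym x = 0} \<subseteq> span ({x. q x = 0} \<union> range s_grp)"
    by auto
next
  have "q_sym x = 0" if "q x = 0" for x :: "'a free_group \<Rightarrow>\<^sub>0 real"
    using that by (simp add: q_sym_eq linear_diff[OF linear_q] q_inverse_basis)
  moreover have "q_sym (s_grp w) = 0" for w :: "'a free_group"
    by (simp add: s_grp_def q_sym_eq linear_add[OF linear_inverse_basis] linear_0[OF linear_q])
  ultimately show "span ({x. q x = 0} \<union> range s_grp) \<subseteq> {x :: 'a free_group \<Rightarrow>\<^sub>0 real. q_sym x = 0}"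
    by (intro span_minimal linear_subspace_kernel[OF linear_q_sym]) auto
qed

lemma span_span_Un: "span (span A \<union> B) = span (A \<union> B)"
  by (rule span_eq[THEN iffD2])
    (auto intro: span_base span_mono[THEN subsetD, of A])

theorem theorem1p3:
  assumes "CARD('a::finite) \<ge> 2"
  shows "{x :: 'a list \<Rightarrow>\<^sub>0 real. q x = 0} = span (\<Union>w. {l_mon w, r_mon w}) \<and>
    {x :: 'a free_group \<Rightarrow>\<^sub>0 real. q x = 0} = span (\<Union>w. {l_grp w, r_grp w}) \<and>
    {x :: 'a free_group \<Rightarrow>\<^sub>0 real. q_sym x = 0} = span (\<Union>w. {l_grp w, r_grp w, s_grp w})"
proof (intro conjI)
  have "(\<Union>w. {l_grp w, r_grp w}) \<union> range s_grp =
      (\<Union>w :: 'a free_group. {l_grp w, r_grp w, s_grp w})"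
    by auto
  then show "{x :: 'a free_group \<Rightarrow>\<^sub>0 real. q_sym x = 0} =
      span (\<Union>w. {l_grp w, r_grp w, s_grp w})"
    unfolding kernel_q_sym kernel_free_group[OF assms] span_span_Un by (rule arg_cong)
qed (rule kernel_free_monoid kernel_free_group[OF assms])+

end
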